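(* Let $\mathbb{F}$ be a field and let $A$ be a locally matrix algebra over $\mathbb{F}$. (1) The ideal $\mathrm{Inder}(A)$ of inner derivations is dense in $\mathrm{Der}(A)$ in the Tykhonoff topology. (2) Suppose that $A$ contains a unit $1$. Then the completion (closure) of $\mathrm{Inn}(A)$ in $\mathrm{Map}(A,A)$ in the Tykhonoff topology is the semigroup $P(A)$ of unital injective endomorphisms of $A$. In particular, $\mathrm{Inn}(A)$ is dense in $\mathrm{Aut}(A)$.
   Context: An associative $\mathbb{F}$-algebra $A$ (not necessarily with unit) is a locally matrix algebra if every finite subset of $A$ is contained in a subalgebra $B\subset A$ with $B\cong M_n(\mathbb{F})$ for some $n$. $\mathrm{Der}(A)$ is the Lie algebra of all derivations, i.e. $\mathbb{F}$-linear maps $d:A\to A$ with $d(xy)=d(x)y+xd(y)$ for all $x,y\in A$; $\mathrm{Inder}(A)$ is the ideal of inner derivations $\mathrm{ad}_A(a):x\mapsto [a,x]=ax-xa$, $a\in A$. $\mathrm{Aut}(A)$ is the group of $\mathbb{F}$-algebra automorphisms of $A$; for unital $A$, $\mathrm{Inn}(A)$ is the group of inner automorphisms $x\mapsto a^{-1}xa$, $a\in A$ invertible; $P(A)$ is the semigroup of injective $\mathbb{F}$-algebra endomorphisms $\varphi$ of $A$ with $\varphi(1)=1$, so $\mathrm{Aut}(A)\subseteq P(A)$. For a set $X$, $\mathrm{Map}(X,X)$ is the set of all maps $X\to X$. The Tykhonoff topology on it is the topology generated by the sets $\{f:X\to X \mid f(a_i)=b_i,\ 1\le i\le n\}$, where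 $n\ge 1$, $a_1,\dots,a_n\in X$ are distinct and $b_1,\dots,b_n\in X$ are arbitrary. Thus $f$ lies in the completion (closure) $\overline{S}$ of $S\subseteq \mathrm{Map}(X,X)$ if and only if for all $n\ge1$ and $a_1,\dots,a_n\in X$ there is $g\in S$ with $f(a_i)=g(a_i)$ for $1\le i\le n$. *)

theory Defs
  imports "HOL-Analysis.Function_Topology" "Jordan_Normal_Form.Matrix"
begin

section \<open>Associative algebras over a field\<close>

text \<open>The type class \<^class>\<open>ring\<close> has no multiplicative unit, so an algebra is a vector space
  structure on a type of that class, not assumed unital.\<close>

locale assoc_algebra = vector_space smul
  for smul :: "'f::field \<Rightarrow> 'a::ring \<Rightarrow> 'a" +
  assumes scale_mult_left: "smul c x * y = smul c (x * y)"
    and scale_mult_right: "x * smul c y = smul c (x * y)"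

definition subalgebra :: "('f::field \<Rightarrow> 'a::ring \<Rightarrow> 'a) \<Rightarrow> 'a set \<Rightarrow> bool" where
  "subalgebra smul B \<longleftrightarrow> module.subspace smul B \<and> (\<forall>x\<in>B. \<forall>y\<in>B. x * y \<in> B)"

definition iso_matrix_algebra :: "('f::field \<Rightarrow> 'a::ring \<Rightarrow> 'a) \<Rightarrow> 'a set \<Rightarrow> nat \<Rightarrow> bool" where
  "iso_matrix_algebra smul B n \<longleftrightarrow>
    (\<exists>\<phi> :: 'a \<Rightarrow> 'f mat. bij_betw \<phi> B (carrier_mat n n) \<and>
      (\<forall>x\<in>B. \<forall>y\<in>B. \<phi> (x + y) = \<phi> x + \<phi> y) \<and>
      (\<forall>c. \<forall>x\<in>B. \<phi> (smul c x) = c \<cdot>\<^sub>m \<phi> x) \<and>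
      (\<forall>x\<in>B. \<forall>y\<in>B. \<phi> (x * y) = \<phi> x * \<phi> y))"

definition locally_matrix_algebra :: "('f::field \<Rightarrow> 'a::ring \<Rightarrow> 'a) \<Rightarrow> bool" where
  "locally_matrix_algebra smul \<longleftrightarrow> assoc_algebra smul \<and>
    (\<forall>S. finite S \<longrightarrow>
      (\<exists>B n. S \<subseteq> B \<and> subalgebra smul B \<and> n \<ge> 1 \<and> iso_matrix_algebra smul B n))"

definition identity_element :: "'a::ring \<Rightarrow> bool" where
  "identity_element e \<longleftrightarrow> (\<forall>x. e * x = x \<and> x * e = x)"

section \<open>Derivations, automorphisms and endomorphisms\<close>

definition Der :: "('f::field \<Rightarrow> 'a::ring \<Rightarrow> 'a) \<Rightarrow> ('a \<Rightarrow> 'a) set" where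
  "Der smul = {d. Vector_Spaces.linear smul smul d \<and> (\<forall>x y. d (x * y) = d x * y + x * d y)}"

definition ad :: "'a::ring \<Rightarrow> 'a \<Rightarrow> 'a" where
  "ad a x = a * x - x * a"

definition Inder :: "('a::ring \<Rightarrow> 'a) set" where
  "Inder = range ad"

definition algebra_endo :: "('f::field \<Rightarrow> 'a::ring \<Rightarrow> 'a) \<Rightarrow> ('a \<Rightarrow> 'a) \<Rightarrow> bool" where
  "algebra_endo smul \<phi> \<longleftrightarrow>
    Vector_Spaces.linear smul smul \<phi> \<and> (\<forall>x y. \<phi> (x * y) = \<phi> x * \<phi> y)"

definition Aut :: "('f::field \<Rightarrow> 'a::ring \<Rightarrow> 'a) \<Rightarrow> ('a \<Rightarrow> 'a) set" where
  "Aut smul = {\<phi>. algebra_endo smul \<phi> \<and> bij \<phi>}"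

text \<open>In the next two definitions \<open>e\<close> is the unit of the algebra.\<close>

definition Inn :: "'a::ring \<Rightarrow> ('a \<Rightarrow> 'a) set" where
  "Inn e = {\<lambda>x. b * x * a |a b. a * b = e \<and> b * a = e}"

definition unital_inj_endos :: "('f::field \<Rightarrow> 'a::ring \<Rightarrow> 'a) \<Rightarrow> 'a \<Rightarrow> ('a \<Rightarrow> 'a) set" where
  "unital_inj_endos smul e = {\<phi>. algebra_endo smul \<phi> \<and> inj \<phi> \<and> \<phi> e = e}"

section \<open>The Tykhonoff topology\<close>

definition tykhonoff :: "('a \<Rightarrow> 'a) topology" where
  "tykhonoff = topology_generated_by
    {{f. \<forall>i<n. f (a i) = b i} |(n::nat) a b. n \<ge> 1 \<and> inj_on a {..<n}}"

definition dense_in :: "'b topology \<Rightarrow> 'b set \<Rightarrow> bool" where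
  "dense_in T S \<longleftrightarrow> S \<subseteq> topspace T \<and> T closure_of S = topspace T"

end

theory Submission
  imports Defs "Jordan_Normal_Form.Determinant"
begin

text \<open>In the Tykhonoff topology a map lies in the closure of a set \<open>S\<close> exactly when it
  agrees with some member of \<open>S\<close> on each finite set (\<open>closure_of_tykhonoff_iff\<close>). A finite
  subset of a locally matrix algebra lies in the span of a finite system of matrix units
  \<open>E\<^sub>i\<^sub>j\<close>, so both density statements reduce to controlling a map on one such system.

  For a derivation \<open>d\<close> this is the separability of the matrix algebra: with the Casimir tensor
  \<open>\<Sum>\<^sub>i E\<^sub>i\<^sub>0 \<otimes> E\<^sub>0\<^sub>i\<close>, whose two module structures agree, the element
  \<open>c = \<Sum>\<^sub>i d(E\<^sub>i\<^sub>0) E\<^sub>0\<^sub>i\<close> satisfies \<open>[c, x] = d(x) e\<close>, where \<open>e = \<Sum>\<^sub>i E\<^sub>i\<^sub>i\<close>.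
  As \<open>e\<close> need not be a unit of the whole algebra, the missing part \<open>x d(e)\<close> of
  \<open>d(x) = d(x e)\<close> is supplied by the inner derivation of \<open>- e d(e)\<close>
  (\<open>derivation_inner_on_matrix_units\<close>).

  For a unital endomorphism \<open>\<phi>\<close> this is a Skolem-Noether argument: the systems \<open>E\<^sub>i\<^sub>j\<close> and
  \<open>F\<^sub>i\<^sub>j = \<phi>(E\<^sub>i\<^sub>j)\<close> both have diagonal sum \<open>1\<close>, and have to be conjugate.
  Comparing ranks is replaced by a softer fact. Inside a larger matrix algebra any two
  idempotents are comparable: one of them factors through the other (\<open>idempotents_comparable\<close>), because one of
  two vector spaces always embeds into the other. A factorization of \<open>E\<^sub>0\<^sub>0\<close> through
  \<open>F\<^sub>0\<^sub>0\<close> spreads along the matrix units to elements with \<open>u v = 1\<close> and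
  \<open>u F\<^sub>k\<^sub>l v = E\<^sub>k\<^sub>l\<close> (\<open>intertwining_units\<close>); since one-sided inverses of matrices are
  two-sided, also \<open>v u = 1\<close>, so \<open>u\<close> conjugates one system into the other.

  Conversely, being linear, multiplicative, injective and unital are conditions on finitely
  many values at a time, so they pass to the closure.\<close>

section \<open>Finite agreement and the Tykhonoff topology\<close>

lemma openin_tykhonoff_agreeing:
  assumes "finite X"
  shows "openin tykhonoff {g. \<forall>x\<in>X. g x = f x}"
proof (cases "X = {}")
  case True
  \<comment> \<open>Prescribing one value already gives a generating set, so the generating
    sets cover everything.\<close>
  have "f' \<in> topspace tykhonoff" for f' :: "'a \<Rightarrow> 'a"
  proof -
    have "{g. \<forall>i<1::nat. g ((\<lambda>_. undefined) i) = (\<lambda>_. f' undefined) i} \<in>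
        {{f. \<forall>i<n. f (a i) = b i} |(n::nat) (a :: nat \<Rightarrow> 'a) b. n \<ge> 1 \<and> inj_on a {..<n}}"
      by (rule CollectI, intro exI conjI, rule refl) (auto simp: inj_on_def)
    then show ?thesis
      unfolding tykhonoff_def topology_generated_by_topspace by (rule UnionI) simp
  qed
  then have "topspace (tykhonoff :: ('a \<Rightarrow> 'a) topology) = UNIV"
    by auto
  then show ?thesis
    using True openin_topspace[of "tykhonoff :: ('a \<Rightarrow> 'a) topology"] by simp
next
  case False
  obtain a where a: "bij_betw a {..<card X} X"
    using ex_bij_betw_nat_finite[OF assms] unfolding atLeast0LessThan by blast
  then have "inj_on a {..<card X}" and img: "a ` {..<card X} = X"
    by (auto simp: bij_betw_def)
  moreover have "{g. \<forall>x\<in>X. g x = f x} = {g. \<forall>i<card X. g (a i) = f (a i)}"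
    using ball_simps(9)[of a "{..<card X}"] unfolding img by (simp add: Ball_def)
  moreover have "card X \<ge> 1"
    using False assms by (simp add: Suc_le_eq card_gt_0_iff)
  ultimately show ?thesis
    unfolding tykhonoff_def
    by (intro topology_generated_by_Basis CollectI exI[of _ "card X"] exI[of _ a]
        exI[of _ "\<lambda>i. f (a i)"]) auto
qed

lemma openin_tykhonoffD:
  assumes "openin tykhonoff U" and "f \<in> U"
  shows "\<exists>X. finite X \<and> {g. \<forall>x\<in>X. g x = f x} \<subseteq> U"
proof -
  have "generate_topology_on {{f. \<forall>i<n. f (a i) = b i} |(n::nat) a b. n \<ge> 1 \<and> inj_on a {..<n}} U"
    using assms(1) unfolding tykhonoff_def by (rule openin_topology_generated_by)
  then show ?thesis
    using assms(2)
  proof (induction U rule: generate_topology_on.induct)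
    case Empty
    then show ?case by simp
  next
    case (Int V W)
    then obtain X Y where "finite X" "{g. \<forall>x\<in>X. g x = f x} \<subseteq> V"
        "finite Y" "{g. \<forall>x\<in>Y. g x = f x} \<subseteq> W"
      by blast
    then show ?case
      by (intro exI[of _ "X \<union> Y"]) auto
  next
    case (UN K)
    then obtain V where "V \<in> K" "f \<in> V"
      by blast
    moreover from this obtain X where "finite X" "{g. \<forall>x\<in>X. g x = f x} \<subseteq> V"
      using UN.IH by blast
    ultimately show ?case
      by (intro exI[of _ X]) auto
  next
    case (Basis V)
    then obtain n :: nat and a b where "V = {f. \<forall>i<n. f (a i) = b i}"
      by blast
    with Basis.prems have "{g. \<forall>x\<in>a ` {..<n}. g x = f x} \<subseteq> V"
      by auto
    then show ?case
      by (intro exI[of _ "a ` {..<n}"]) simp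
  qed
qed

lemma closure_of_tykhonoff_iff:
  "f \<in> tykhonoff closure_of S \<longleftrightarrow> (\<forall>X. finite X \<longrightarrow> (\<exists>g\<in>S. \<forall>x\<in>X. g x = f x))"
proof -
  have "f \<in> topspace tykhonoff"
    using openin_subset[OF openin_tykhonoff_agreeing[of "{}" f]] by auto
  show ?thesis
  proof
    assume f: "f \<in> tykhonoff closure_of S"
    show "\<forall>X. finite X \<longrightarrow> (\<exists>g\<in>S. \<forall>x\<in>X. g x = f x)"
    proof (intro allI impI)
      fix X :: "'a set"
      assume "finite X"
      then have "openin tykhonoff {g. \<forall>x\<in>X. g x = f x}"
        by (rule openin_tykhonoff_agreeing)
      then have "\<exists>g. g \<in> S \<and> g \<in> {g. \<forall>x\<in>X. g x = f x}"
        by (intro conjunct2[OF f[unfolded in_closure_of], rule_format] conjI) simp_all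
      then show "\<exists>g\<in>S. \<forall>x\<in>X. g x = f x"
        by auto
    qed
  next
    assume agree: "\<forall>X. finite X \<longrightarrow> (\<exists>g\<in>S. \<forall>x\<in>X. g x = f x)"
    show "f \<in> tykhonoff closure_of S"
      unfolding in_closure_of
    proof (intro conjI allI impI)
      fix U
      assume "f \<in> U \<and> openin tykhonoff U"
      then obtain X where "finite X" "{g. \<forall>x\<in>X. g x = f x} \<subseteq> U"
        using openin_tykhonoffD[of U f] by auto
      moreover from this agree obtain g where "g \<in> S" "\<forall>x\<in>X. g x = f x"
        by meson
      ultimately show "\<exists>g. g \<in> S \<and> g \<in> U"
        by auto
    qed fact
  qed
qed

lemma dense_in_tykhonoff_subtopology:
  assumes "S \<subseteq> D" and "D \<subseteq> tykhonoff closure_of S"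
  shows "dense_in (subtopology tykhonoff D) S"
proof -
  have "topspace (subtopology tykhonoff D) = D"
    using closure_of_subset_topspace[of tykhonoff S] assms(2) by auto
  moreover have "D \<inter> S = S"
    using assms(1) by blast
  ultimately show ?thesis
    unfolding dense_in_def closure_of_subtopology using assms by auto
qed

section \<open>Systems of matrix units\<close>

definition matrix_units :: "nat \<Rightarrow> (nat \<Rightarrow> nat \<Rightarrow> 'a::ring) \<Rightarrow> bool" where
  "matrix_units n E \<longleftrightarrow>
    (\<forall>i<n. \<forall>j<n. \<forall>k<n. \<forall>l<n. E i j * E k l = (if j = k then E i l else 0))"

definition unit_entries :: "nat \<Rightarrow> (nat \<Rightarrow> nat \<Rightarrow> 'a) \<Rightarrow> 'a set" where
  "unit_entries n E = (\<lambda>(i, j). E i j) ` ({..<n} \<times> {..<n})"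

lemma matrix_unitsD:
  assumes "matrix_units n E" "i < n" "j < n" "k < n" "l < n"
  shows "E i j * E k l = (if j = k then E i l else 0)"
  using assms unfolding matrix_units_def by blast

lemma unit_entriesI: "i < n \<Longrightarrow> j < n \<Longrightarrow> E i j \<in> unit_entries n E"
  unfolding unit_entries_def by force

lemma unit_entriesE:
  assumes "x \<in> unit_entries n E"
  obtains i j where "i < n" "j < n" "x = E i j"
  using assms unfolding unit_entries_def by auto

context assoc_algebra
begin

interpretation endo: vector_space_pair smul smul ..

lemma linear_mult_left: "Vector_Spaces.linear smul smul (\<lambda>x. a * x)"
  by unfold_locales (simp_all add: algebra_simps scale_mult_right)

lemma linear_mult_right: "Vector_Spaces.linear smul smul (\<lambda>x. x * a)"
  by unfold_locales (simp_all add: algebra_simps scale_mult_left)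

lemma linear_comp:
  assumes "Vector_Spaces.linear smul smul f" "Vector_Spaces.linear smul smul g"
  shows "Vector_Spaces.linear smul smul (\<lambda>x. f (g x))"
  using Vector_Spaces.linear_compose[OF assms(2,1)] by (simp add: o_def)

lemma linear_fixes_span:
  assumes "Vector_Spaces.linear smul smul f" and "\<And>b. b \<in> B \<Longrightarrow> f b = b" and "x \<in> span B"
  shows "f x = x"
  using endo.linear_eq_on[OF assms(1) linear_id assms(3)] assms(2) by simp

lemma sum_diagonal_units:
  assumes E: "matrix_units n E" and x: "x \<in> span (unit_entries n E)"
  shows "(\<Sum>i<n. E i i) * x = x" and "x * (\<Sum>i<n. E i i) = x"
proof -
  have "(\<Sum>i<n. E i i) * b = b" "b * (\<Sum>i<n. E i i) = b" if "b \<in> unit_entries n E" for b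
    using that
    by (auto elim!: unit_entriesE simp: sum_distrib_left sum_distrib_right matrix_unitsD[OF E])
  then show "(\<Sum>i<n. E i i) * x = x" "x * (\<Sum>i<n. E i i) = x"
    using linear_fixes_span[OF linear_mult_left _ x] linear_fixes_span[OF linear_mult_right _ x]
    by blast+
qed

section \<open>Derivations on matrix units\<close>

text \<open>On a matrix unit \<open>x = E\<^sub>k\<^sub>l\<close> each side has a single nonzero term, and both of them
  are \<open>d(E\<^sub>k\<^sub>0) E\<^sub>0\<^sub>l\<close>. This is the equality
  \<open>\<Sum>\<^sub>i x E\<^sub>i\<^sub>0 \<otimes> E\<^sub>0\<^sub>i = \<Sum>\<^sub>i E\<^sub>i\<^sub>0 \<otimes> E\<^sub>0\<^sub>i x\<close> after applying
  \<open>y \<otimes> z \<mapsto> d(y) z\<close>.\<close>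

lemma casimir_identity:
  assumes E: "matrix_units n E" and "0 < n" and x: "x \<in> span (unit_entries n E)"
    and d: "Vector_Spaces.linear smul smul d"
  shows "(\<Sum>i<n. d (x * E i 0) * E 0 i) = (\<Sum>i<n. d (E i 0) * E 0 i) * x"
proof (rule endo.linear_eq_on[OF _ linear_mult_left x])
  show "Vector_Spaces.linear smul smul (\<lambda>x. \<Sum>i<n. d (x * E i 0) * E 0 i)"
    by (intro endo.linear_compose_sum ballI linear_comp[OF linear_mult_right]
        linear_comp[OF d] linear_mult_right)
  interpret d: Vector_Spaces.linear smul smul d
    by (rule d)
  fix b
  assume "b \<in> unit_entries n E"
  then obtain k l where kl: "k < n" "l < n" "b = E k l"
    by (rule unit_entriesE)
  have "(\<Sum>i<n. d (b * E i 0) * E 0 i) = (\<Sum>i<n. if i = l then d (E k 0) * E 0 l else 0)"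
    using kl \<open>0 < n\<close> by (intro sum.cong) (auto simp: matrix_unitsD[OF E] d.zero)
  also have "\<dots> = d (E k 0) * E 0 l"
    using kl by simp
  also have "\<dots> = (\<Sum>i<n. if i = k then d (E k 0) * E 0 l else 0)"
    using kl by simp
  also have "\<dots> = (\<Sum>i<n. d (E i 0) * E 0 i) * b"
    unfolding sum_distrib_right
    using kl \<open>0 < n\<close> by (intro sum.cong) (auto simp: mult.assoc matrix_unitsD[OF E])
  finally show "(\<Sum>i<n. d (b * E i 0) * E 0 i) = (\<Sum>i<n. d (E i 0) * E 0 i) * b" .
qed

text \<open>The Leibniz rule turns the left side of the Casimir identity into \<open>d(x) e + x c\<close>, where
  \<open>c\<close> is the sum below; hence \<open>[c, x] = d(x) e\<close>. The correction
  \<open>- e d(e)\<close> adds exactly \<open>x d(e)\<close>: applying \<open>d\<close> to \<open>e e = e\<close> gives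
  \<open>e d(e) e = 0\<close> and thus \<open>e d(e) x = 0\<close>, while \<open>x (e d(e)) = x d(e)\<close>.\<close>

lemma derivation_inner_on_matrix_units:
  assumes E: "matrix_units n E" and "0 < n" and d: "d \<in> Der smul"
  defines "e \<equiv> \<Sum>i<n. E i i"
  assumes x: "x \<in> span (unit_entries n E)"
  shows "ad ((\<Sum>i<n. d (E i 0) * E 0 i) - e * d e) x = d x"
proof -
  let ?c = "\<Sum>i<n. d (E i 0) * E 0 i"
  have lin: "Vector_Spaces.linear smul smul d" and der: "d (y * z) = d y * z + y * d z" for y z
    using d by (auto simp: Der_def)
  have "e \<in> span (unit_entries n E)"
    unfolding e_def by (intro span_sum span_base unit_entriesI) auto
  then have ee: "e * e = e" and ex: "e * x = x" and xe: "x * e = x"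
    using sum_diagonal_units[OF E] x unfolding e_def by auto
  have "e * d e = e * d e * e + e * d e"
    using der[of e e] ee by (metis distrib_left mult.assoc)
  then have ede: "e * d e * e = 0"
    by simp
  have "e * d e * x = e * d e * e * x"
    by (simp add: mult.assoc ex)
  then have 1: "e * d e * x = 0"
    by (simp add: ede)
  have 2: "x * (e * d e) = x * d e"
    by (simp add: mult.assoc[symmetric] xe)
  have "?c * x = (\<Sum>i<n. d (x * E i 0) * E 0 i)"
    using casimir_identity[OF E \<open>0 < n\<close> x lin] by simp
  also have "\<dots> = (\<Sum>i<n. d x * (E i 0 * E 0 i) + x * (d (E i 0) * E 0 i))"
    by (simp add: der distrib_right mult.assoc)
  also have "\<dots> = (\<Sum>i<n. d x * E i i + x * (d (E i 0) * E 0 i))"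
    using \<open>0 < n\<close> by (intro sum.cong) (auto simp: matrix_unitsD[OF E])
  also have "\<dots> = d x * e + x * ?c"
    by (simp add: sum.distrib sum_distrib_left e_def)
  finally have "ad (?c - e * d e) x = d x * e + x * d e"
    using 1 2 by (simp add: ad_def left_diff_distrib right_diff_distrib)
  also have "\<dots> = d x"
    using der[of x e] xe by simp
  finally show ?thesis .
qed

section \<open>Comparing idempotents\<close>

text \<open>Both the embedding \<open>T\<close> and its retraction \<open>R\<close> are linear maps of the whole algebra, so that
  they compose with multiplications by arbitrary elements.\<close>

definition split_embeds :: "'a set \<Rightarrow> 'a set \<Rightarrow> bool" where
  "split_embeds U W \<longleftrightarrow> (\<exists>T R. Vector_Spaces.linear smul smul T \<and> Vector_Spaces.linear smul smul R \<and>
    (\<forall>u\<in>U. T u \<in> W \<and> R (T u) = u))"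

lemma split_embeds_of_bases:
  assumes "subspace W"
    and S: "independent S" "U \<subseteq> span S"
    and T: "independent T" "T \<subseteq> W"
    and h: "inj_on h S" "h ` S \<subseteq> T"
  shows "split_embeds U W"
proof -
  obtain L where L: "Vector_Spaces.linear smul smul L" "\<forall>s\<in>S. L s = h s"
    using endo.linear_independent_extend[OF S(1)] by blast
  obtain R where R: "Vector_Spaces.linear smul smul R" "\<forall>t\<in>T. R t = inv_into S h t"
    using endo.linear_independent_extend[OF T(1)] by blast
  have "L u \<in> W" if "u \<in> U" for u
  proof -
    have "L u \<in> span (L ` S)"
      using that S(2) endo.linear_span_image[OF L(1), of S] by blast
    also have "\<dots> \<subseteq> W"
      using L(2) h(2) T(2) by (intro span_minimal assms(1)) auto
    finally show ?thesis .
  qed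
  moreover have "R (L u) = u" if "u \<in> U" for u
  proof -
    have u: "u \<in> span S"
      using that S(2) by blast
    have "R (L s) = s" if "s \<in> S" for s
      using that h R(2) L(2) by (auto simp: inv_into_f_f)
    then show ?thesis
      by (rule linear_fixes_span[OF linear_comp[OF R(1) L(1)] _ u])
  qed
  ultimately show ?thesis
    unfolding split_embeds_def using L(1) R(1) by blast
qed

text \<open>The cardinalities of two bases are comparable, and an injection of bases extends to a split
  embedding of their spans.\<close>

lemma split_embeds_total:
  assumes "subspace U" "subspace W"
  shows "split_embeds U W \<or> split_embeds W U"
proof -
  obtain S where S: "S \<subseteq> U" "independent S" "U \<subseteq> span S"
    by (rule maximal_independent_subset)
  obtain T where T: "T \<subseteq> W" "independent T" "W \<subseteq> span T"
    by (rule maximal_independent_subset)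
  have "(\<exists>h. inj_on h S \<and> h ` S \<subseteq> T) \<or> (\<exists>h. inj_on h T \<and> h ` T \<subseteq> S)"
    unfolding card_of_ordLeq by (rule ordLeq_total[OF card_of_Well_order card_of_Well_order])
  then show ?thesis
    using split_embeds_of_bases[OF assms(2) S(2,3) T(2,1)]
      split_embeds_of_bases[OF assms(1) T(2,3) S(2,1)] by blast
qed

text \<open>If \<open>f\<close> lies in the matrix algebra \<open>C\<close> spanned by \<open>G\<close>, this is \<open>f C G\<^sub>0\<^sub>0\<close>: the column
  space of the matrix \<open>f\<close>, realized inside the algebra.\<close>

definition first_column :: "nat \<Rightarrow> (nat \<Rightarrow> nat \<Rightarrow> 'a) \<Rightarrow> 'a \<Rightarrow> 'a set" where
  "first_column m G f = span ((\<lambda>k. f * G k 0) ` {..<m})"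

text \<open>A linear map between column spaces is left multiplication by an element: the
  sum \<open>\<Sum>\<^sub>k t\<^sub>k G\<^sub>0\<^sub>k\<close> sends each \<open>G\<^sub>k\<^sub>0\<close> to \<open>t\<^sub>k G\<^sub>0\<^sub>0\<close>. Here \<open>q\<close>
  and \<open>p\<close> represent the embedding after projection by \<open>f\<close> and its retraction after
  projection by \<open>g\<close>, so \<open>p q\<close> acts on columns as \<open>f\<close>.\<close>

lemma factor_idempotent:
  assumes G: "matrix_units m G" and "0 < m"
    and f: "f \<in> span (unit_entries m G)"
    and g: "g \<in> span (unit_entries m G)" "g * g = g"
    and emb: "split_embeds (first_column m G f) (first_column m G g)"
  shows "\<exists>p q. p * q = f \<and> g * q = q"
proof -
  obtain T R where T: "Vector_Spaces.linear smul smul T" and R: "Vector_Spaces.linear smul smul R"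
    and TR: "\<And>u. u \<in> first_column m G f \<Longrightarrow> T u \<in> first_column m G g"
      "\<And>u. u \<in> first_column m G f \<Longrightarrow> R (T u) = u"
    using emb unfolding split_embeds_def by blast
  define q where "q = (\<Sum>k<m. T (f * G k 0) * G 0 k)"
  define p where "p = (\<Sum>j<m. R (g * G j 0) * G 0 j)"
  have fk: "f * G k 0 \<in> first_column m G f" if "k < m" for k
    using that unfolding first_column_def by (intro span_base) auto
  have g_fix: "g * z = z" if "z \<in> first_column m G g" for z
  proof (rule linear_fixes_span[OF linear_mult_left])
    show "z \<in> span ((\<lambda>k. g * G k 0) ` {..<m})"
      using that unfolding first_column_def .
  qed (use g(2) in \<open>auto simp: mult.assoc[symmetric]\<close>)
  have in_column: "z \<in> span ((\<lambda>j. G j 0) ` {..<m})" if "z \<in> first_column m G g" for z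
  proof -
    have "g * G k 0 \<in> span ((\<lambda>j. G j 0) ` {..<m})" if "k < m" for k
    proof -
      have "g * G k 0 \<in> span ((\<lambda>x. x * G k 0) ` unit_entries m G)"
        using g(1) endo.linear_span_image[OF linear_mult_right] by blast
      also have "\<dots> \<subseteq> span ((\<lambda>j. G j 0) ` {..<m})"
        using that \<open>0 < m\<close>
        by (intro span_minimal subspace_span)
          (auto elim!: unit_entriesE simp: matrix_unitsD[OF G] span_zero span_base)
      finally show ?thesis .
    qed
    then have "first_column m G g \<subseteq> span ((\<lambda>j. G j 0) ` {..<m})"
      unfolding first_column_def by (intro span_minimal subspace_span) auto
    with that show ?thesis
      by blast
  qed
  \<comment> \<open>Both sides are linear in \<open>z\<close>; the factor \<open>G\<^sub>0\<^sub>0\<close> appears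
    since \<open>R\<close> may take values outside the column.\<close>
  have p_act: "p * z = R (g * z) * G 0 0" if "z \<in> span ((\<lambda>j. G j 0) ` {..<m})" for z
  proof (rule endo.linear_eq_on[OF linear_mult_left linear_comp[OF linear_mult_right
          linear_comp[OF R linear_mult_left]] that])
    fix b
    assume "b \<in> (\<lambda>j. G j 0) ` {..<m}"
    then obtain k where k: "k < m" "b = G k 0"
      by blast
    have "p * b = (\<Sum>j<m. if j = k then R (g * G k 0) * G 0 0 else 0)"
      unfolding p_def sum_distrib_right
      using k \<open>0 < m\<close> by (intro sum.cong) (auto simp: mult.assoc matrix_unitsD[OF G])
    then show "p * b = R (g * b) * G 0 0"
      using k by simp
  qed
  have "p * (T (f * G k 0) * G 0 k) = f * G k k" if "k < m" for k
  proof -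
    have "p * T (f * G k 0) = R (T (f * G k 0)) * G 0 0"
      using p_act in_column g_fix TR(1) fk that by simp
    then show ?thesis
      using TR(2) fk that \<open>0 < m\<close>
      by (simp add: mult.assoc[symmetric]) (simp add: mult.assoc matrix_unitsD[OF G])
  qed
  then have "p * q = f * (\<Sum>k<m. G k k)"
    unfolding q_def sum_distrib_left by (intro sum.cong) auto
  then have "p * q = f"
    using sum_diagonal_units(2)[OF G f] by simp
  moreover have "g * q = q"
    unfolding q_def sum_distrib_left
    using g_fix TR(1) fk by (intro sum.cong) (auto simp: mult.assoc[symmetric])
  ultimately show ?thesis
    by blast
qed

text \<open>The first alternative writes \<open>f\<close> as \<open>p g q\<close>, which means that the rank of \<open>f\<close> is at most
  that of \<open>g\<close>; the second one is the reverse inequality. The two column spaces decide which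
  one holds.\<close>

lemma idempotents_comparable:
  assumes "matrix_units m G" and "0 < m"
    and "f \<in> span (unit_entries m G)" "f * f = f"
    and "g \<in> span (unit_entries m G)" "g * g = g"
  shows "(\<exists>p q. p * q = f \<and> g * q = q) \<or> (\<exists>p q. p * q = g \<and> f * q = q)"
  using split_embeds_total[of "first_column m G f" "first_column m G g"]
    factor_idempotent[OF assms(1,2,3,5,6)] factor_idempotent[OF assms(1,2,5,3,4)]
  unfolding first_column_def by (auto intro: subspace_span)

section \<open>Transfer from matrices\<close>

text \<open>The preimages \<open>E\<close> of the elementary matrices \<open>e\<close> form the system, and an element is
  recovered from the entries of its image.\<close>

lemma iso_matrix_algebra_units:
  assumes B: "subalgebra smul B" and iso: "iso_matrix_algebra smul B n"
  shows "\<exists>E. matrix_units n E \<and> B \<subseteq> span (unit_entries n E)"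
proof -
  obtain \<phi> :: "'a \<Rightarrow> 'f mat" where bij: "bij_betw \<phi> B (carrier_mat n n)"
    and add: "\<And>x y. x \<in> B \<Longrightarrow> y \<in> B \<Longrightarrow> \<phi> (x + y) = \<phi> x + \<phi> y"
    and scale: "\<And>c x. x \<in> B \<Longrightarrow> \<phi> (smul c x) = c \<cdot>\<^sub>m \<phi> x"
    and mult: "\<And>x y. x \<in> B \<Longrightarrow> y \<in> B \<Longrightarrow> \<phi> (x * y) = \<phi> x * \<phi> y"
    using iso unfolding iso_matrix_algebra_def by blast
  have sub: "subspace B" and mem: "\<And>x y. x \<in> B \<Longrightarrow> y \<in> B \<Longrightarrow> x * y \<in> B"
    using B unfolding subalgebra_def by auto
  have inj: "x = y" if "\<phi> x = \<phi> y" "x \<in> B" "y \<in> B" for x y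
    using that bij by (meson bij_betw_imp_inj_on inj_onD)
  have carr: "\<phi> x \<in> carrier_mat n n" if "x \<in> B" for x
    using that bij_betwE[OF bij] by blast
  have "(0::'f) \<cdot>\<^sub>m \<phi> 0 = 0\<^sub>m n n"
    using carr[OF subspace_0[OF sub]] by (intro eq_matI) auto
  then have zero: "\<phi> 0 = 0\<^sub>m n n"
    using scale[OF subspace_0[OF sub], of 0] by simp
  define e where "e i j = mat n n (\<lambda>ab. if ab = (i, j) then (1::'f) else 0)" for i j
  define E where "E i j = inv_into B \<phi> (e i j)" for i j
  have e_carr: "e i j \<in> carrier_mat n n" for i j
    by (simp add: e_def)
  have EB: "E i j \<in> B" and \<phi>E: "\<phi> (E i j) = e i j" for i j
    using e_carr[of i j] bij_betw_imp_surj_on[OF bij] unfolding E_def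
    by (auto intro: inv_into_into f_inv_into_f)
  have ee: "e i j * e k l = (if j = k then e i l else 0\<^sub>m n n)" if "j < n" "k < n" for i j k l
  proof (rule eq_matI)
    fix a b
    assume "a < dim_row (if j = k then e i l else 0\<^sub>m n n)" "b < dim_col (if j = k then e i l else 0\<^sub>m n n)"
    then have ab: "a < n" "b < n"
      by (auto simp: e_def split: if_splits)
    have "(e i j * e k l) $$ (a, b) =
        (\<Sum>c<n. (if (a, c) = (i, j) then 1 else 0) * (if (c, b) = (k, l) then 1 else 0))"
      using ab by (simp add: e_def scalar_prod_def atLeast0LessThan)
    also have "\<dots> = (\<Sum>c<n. if c = j then (if a = i \<and> j = k \<and> b = l then 1 else 0) else 0)"
      by (intro sum.cong) auto
    also have "\<dots> = (if j = k then e i l else 0\<^sub>m n n) $$ (a, b)"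
      using ab that by (simp add: e_def)
    finally show "(e i j * e k l) $$ (a, b) = (if j = k then e i l else 0\<^sub>m n n) $$ (a, b)" .
  qed (auto simp: e_def)
  have "E i j * E k l = (if j = k then E i l else 0)" if "j < n" "k < n" for i j k l
    by (rule inj) (use that ee in \<open>auto simp: mult EB \<phi>E mem zero subspace_0[OF sub]\<close>)
  then have "matrix_units n E"
    unfolding matrix_units_def by blast
  moreover have "x \<in> span (unit_entries n E)" if x: "x \<in> B" for x
  proof -
    let ?y = "\<lambda>K. \<Sum>(i, j)\<in>K. smul (\<phi> x $$ (i, j)) (E i j)"
    have "?y K \<in> B \<and> \<phi> (?y K) = mat n n (\<lambda>ij. if ij \<in> K then \<phi> x $$ ij else 0)"
      if "finite K" for K
      using that
    proof (induction K)
      case empty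
      then show ?case
        by (auto simp: zero subspace_0[OF sub] intro!: eq_matI)
    next
      case (insert k K)
      obtain a b where k: "k = (a, b)"
        by (cases k)
      have term_in: "smul (\<phi> x $$ (a, b)) (E a b) \<in> B"
        by (rule subspace_scale[OF sub EB])
      have y: "?y (insert k K) = smul (\<phi> x $$ (a, b)) (E a b) + ?y K"
        using insert.hyps k by simp
      have "\<phi> (?y (insert k K)) = \<phi> x $$ (a, b) \<cdot>\<^sub>m e a b + \<phi> (?y K)"
        unfolding y using insert.IH by (simp only: add term_in scale EB \<phi>E)
      also have "\<dots> = mat n n (\<lambda>ij. if ij \<in> insert k K then \<phi> x $$ ij else 0)"
        using insert.hyps(2) k unfolding insert.IH[THEN conjunct2]
        by (intro eq_matI) (auto simp: e_def)
      finally show ?case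
        unfolding y using subspace_add[OF sub term_in] insert.IH by simp
    qed
    from this[of "{..<n} \<times> {..<n}"] have "?y ({..<n} \<times> {..<n}) \<in> B"
      "\<phi> (?y ({..<n} \<times> {..<n})) = mat n n (\<lambda>ij. if ij \<in> {..<n} \<times> {..<n} then \<phi> x $$ ij else 0)"
      by auto
    moreover have "mat n n (\<lambda>ij. if ij \<in> {..<n} \<times> {..<n} then \<phi> x $$ ij else 0) = \<phi> x"
      using carr[OF x] by (auto intro!: eq_matI)
    ultimately have "x = ?y ({..<n} \<times> {..<n})"
      using inj x by simp
    also have "\<dots> \<in> span (unit_entries n E)"
      by (intro span_sum) (auto simp: span_scale span_base unit_entriesI)
    finally show ?thesis .
  qed
  ultimately show ?thesis
    by blast
qed

text \<open>A unit of the algebra that lies in \<open>B\<close> must correspond to the identity matrix, so the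
  claim is the one for square matrices over a field.\<close>

lemma iso_matrix_algebra_directly_finite:
  assumes B: "subalgebra smul B" and iso: "iso_matrix_algebra smul B n"
    and e: "identity_element e" and uv: "u \<in> B" "v \<in> B" "u * v = e"
  shows "v * u = e"
proof -
  obtain \<phi> :: "'a \<Rightarrow> 'f mat" where bij: "bij_betw \<phi> B (carrier_mat n n)"
    and mult: "\<And>x y. x \<in> B \<Longrightarrow> y \<in> B \<Longrightarrow> \<phi> (x * y) = \<phi> x * \<phi> y"
    using iso unfolding iso_matrix_algebra_def by blast
  have mem: "\<And>x y. x \<in> B \<Longrightarrow> y \<in> B \<Longrightarrow> x * y \<in> B"
    using B unfolding subalgebra_def by auto
  have carr: "\<phi> x \<in> carrier_mat n n" if "x \<in> B" for x
    using that bij_betwE[OF bij] by blast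
  have eB: "e \<in> B"
    using mem uv by blast
  \<comment> \<open>The element \<open>w\<close> is the unit of \<open>B\<close>, so it has to coincide with \<open>e\<close>.\<close>
  obtain w where w: "w \<in> B" "\<phi> w = 1\<^sub>m n"
    using bij_betw_imp_surj_on[OF bij] by (metis imageE one_carrier_mat)
  have "\<phi> e = \<phi> e * \<phi> w"
    using w(2) carr[OF eB] by simp
  also have "\<dots> = \<phi> w"
    using mult[OF eB w(1)] e by (simp add: identity_element_def)
  finally have \<phi>e: "\<phi> e = 1\<^sub>m n"
    using w(2) by simp
  then have "\<phi> u * \<phi> v = 1\<^sub>m n"
    using mult[OF uv(1,2)] uv(3) by simp
  then have "\<phi> v * \<phi> u = 1\<^sub>m n"
    by (rule mat_mult_left_right_inverse[OF carr carr, OF uv(1,2)])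
  then have "\<phi> (v * u) = \<phi> e"
    using mult[OF uv(2,1)] \<phi>e by simp
  then show ?thesis
    using bij_betw_imp_inj_on[OF bij] mem uv eB by (meson inj_onD)
qed

end

section \<open>Conjugating systems of matrix units\<close>

text \<open>The elements \<open>u = \<Sum>\<^sub>i E\<^sub>i\<^sub>0 p F\<^sub>0\<^sub>i\<close> and \<open>v = \<Sum>\<^sub>i F\<^sub>i\<^sub>0 q E\<^sub>0\<^sub>i\<close> copy the
  factorization \<open>E\<^sub>0\<^sub>0 = p q\<close> to every diagonal position. In \<open>u F\<^sub>k\<^sub>l v\<close> only the
  \<open>k\<close>-th summand of \<open>u\<close> and the \<open>l\<close>-th summand of \<open>v\<close> survive, and they leave
  \<open>E\<^sub>k\<^sub>0 p F\<^sub>0\<^sub>0 q E\<^sub>0\<^sub>l = E\<^sub>k\<^sub>l\<close>.\<close>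

lemma intertwining_units:
  fixes E F :: "nat \<Rightarrow> nat \<Rightarrow> 'a::ring"
  assumes E: "matrix_units n E" and F: "matrix_units n F" and "0 < n"
    and p: "p * q = E 0 0" and q: "F 0 0 * q = q"
  shows "\<exists>u v. u * v = (\<Sum>i<n. E i i) \<and> (\<forall>k<n. \<forall>l<n. u * F k l * v = E k l)"
proof -
  define u where "u = (\<Sum>i<n. E i 0 * p * F 0 i)"
  define v where "v = (\<Sum>i<n. F i 0 * q * E 0 i)"
  have Epq: "x * p * (F 0 0 * (q * y)) = x * E 0 0 * y" for x y
    using p q by (metis mult.assoc)
  have cell: "E i 0 * p * F 0 i * F k l * (F j 0 * q * E 0 j) =
      (if i = k \<and> j = l then E k l else 0)" if "i < n" "j < n" "k < n" "l < n" for i j k l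
  proof -
    have "E i 0 * p * F 0 i * F k l * (F j 0 * q * E 0 j) =
        E i 0 * p * ((F 0 i * F k l * F j 0) * (q * E 0 j))"
      by (simp add: mult.assoc)
    also have "F 0 i * F k l * F j 0 = (if i = k \<and> j = l then F 0 0 else 0)"
      using that \<open>0 < n\<close> by (auto simp: matrix_unitsD[OF F])
    finally show ?thesis
      using that \<open>0 < n\<close> Epq by (auto simp: matrix_unitsD[OF E])
  qed
  have conj: "u * F k l * v = E k l" if kl: "k < n" "l < n" for k l
  proof -
    have "u * F k l * v = (\<Sum>i<n. \<Sum>j<n. E i 0 * p * F 0 i * F k l * (F j 0 * q * E 0 j))"
      unfolding u_def v_def sum_distrib_right sum_distrib_left by (rule sum.swap)
    also have "\<dots> = (\<Sum>i<n. \<Sum>j<n. if i = k then (if j = l then E k l else 0) else 0)"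
      using kl by (intro sum.cong refl) (auto simp: cell)
    also have "\<dots> = (\<Sum>i<n. if i = k then E k l else 0)"
      using kl by (intro sum.cong) auto
    also have "\<dots> = E k l"
      using kl by simp
    finally show ?thesis .
  qed
  have "u * (\<Sum>k<n. F k k) = u"
  proof -
    have "E i 0 * p * F 0 i * (\<Sum>k<n. F k k) = E i 0 * p * F 0 i" if "i < n" for i
      using that \<open>0 < n\<close>
      by (simp add: sum_distrib_left mult.assoc matrix_unitsD[OF F] if_distrib[of "(*) _"] cong: if_cong)
    then show ?thesis
      unfolding u_def sum_distrib_right by (intro sum.cong) auto
  qed
  then have "u * v = (\<Sum>k<n. u * F k k * v)"
    by (metis (no_types) sum_distrib_left sum_distrib_right)
  also have "\<dots> = (\<Sum>k<n. E k k)"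
    using conj by (intro sum.cong) auto
  finally show ?thesis
    using conj by blast
qed

section \<open>Locally matrix algebras\<close>

lemma locally_matrix_algebra_units:
  assumes "locally_matrix_algebra smul" and "finite S"
  shows "\<exists>n E. 0 < n \<and> matrix_units n E \<and> S \<subseteq> module.span smul (unit_entries n E)"
proof -
  interpret assoc_algebra smul
    using assms(1) by (simp add: locally_matrix_algebra_def)
  obtain B n where "S \<subseteq> B" "subalgebra smul B" "n \<ge> 1" "iso_matrix_algebra smul B n"
    using assms unfolding locally_matrix_algebra_def by blast
  moreover from this obtain E where "matrix_units n E" "B \<subseteq> span (unit_entries n E)"
    using iso_matrix_algebra_units by blast
  ultimately show ?thesis
    by (intro exI[of _ n] exI[of _ E]) auto
qed

lemma locally_matrix_algebra_directly_finite:
  fixes smul :: "'f::field \<Rightarrow> 'a::ring \<Rightarrow> 'a" and e :: 'a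
  assumes "locally_matrix_algebra smul" and "identity_element e" and "u * v = e"
  shows "v * u = e"
proof -
  interpret assoc_algebra smul
    using assms(1) by (simp add: locally_matrix_algebra_def)
  have "finite {u, v}"
    by simp
  then obtain B n where B: "{u, v} \<subseteq> B" "subalgebra smul B" "iso_matrix_algebra smul B n"
    using assms(1) unfolding locally_matrix_algebra_def by blast
  then show ?thesis
    using iso_matrix_algebra_directly_finite[OF B(2,3) assms(2) _ _ assms(3)] by simp
qed

text \<open>Whichever of \<open>E\<^sub>0\<^sub>0\<close> and \<open>F\<^sub>0\<^sub>0\<close> factors through the other, the intertwining pair is
  a pair of mutually inverse elements by direct finiteness, so the direction of the
  comparison does not affect the conclusion.\<close>

lemma matrix_units_conjugate:
  fixes smul :: "'f::field \<Rightarrow> 'a::ring \<Rightarrow> 'a" and e :: 'a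
  assumes A: "locally_matrix_algebra smul" and e: "identity_element e"
    and E: "matrix_units n E" "(\<Sum>i<n. E i i) = e"
    and F: "matrix_units n F" "(\<Sum>i<n. F i i) = e" and "0 < n"
  shows "\<exists>a b. a * b = e \<and> b * a = e \<and> (\<forall>k<n. \<forall>l<n. b * E k l * a = F k l)"
proof -
  interpret assoc_algebra smul
    using A by (simp add: locally_matrix_algebra_def)
  obtain m G where G: "0 < m" "matrix_units m G" "{E 0 0, F 0 0} \<subseteq> span (unit_entries m G)"
    using locally_matrix_algebra_units[OF A, of "{E 0 0, F 0 0}"] by auto
  have "E 0 0 * E 0 0 = E 0 0" "F 0 0 * F 0 0 = F 0 0"
    using \<open>0 < n\<close> by (simp_all add: matrix_unitsD[OF E(1)] matrix_unitsD[OF F(1)])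
  then consider p q where "p * q = E 0 0" "F 0 0 * q = q" | p q where "p * q = F 0 0" "E 0 0 * q = q"
    using idempotents_comparable[OF G(2,1), of "E 0 0" "F 0 0"] G(3) by auto
  then show ?thesis
  proof cases
    case 1
    obtain u v where uv: "u * v = e" "\<forall>k<n. \<forall>l<n. u * F k l * v = E k l"
      using intertwining_units[OF E(1) F(1) \<open>0 < n\<close> 1] E(2) by auto
    have vu: "v * u = e"
      by (rule locally_matrix_algebra_directly_finite[OF A e uv(1)])
    have "v * E k l * u = F k l" if "k < n" "l < n" for k l
    proof -
      have "v * E k l * u = (v * u) * F k l * (v * u)"
        using uv(2) that by (metis mult.assoc)
      then show ?thesis
        using vu e by (simp add: identity_element_def)
    qed
    then show ?thesis
      using uv(1) vu by blast
  next
    case 2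
    obtain u v where uv: "u * v = e" "\<forall>k<n. \<forall>l<n. u * E k l * v = F k l"
      using intertwining_units[OF F(1) E(1) \<open>0 < n\<close> 2] F(2) by auto
    then show ?thesis
      using locally_matrix_algebra_directly_finite[OF A e uv(1)] by blast
  qed
qed

lemma derivation_locally_inner:
  assumes A: "locally_matrix_algebra smul" and d: "d \<in> Der smul" and "finite X"
  shows "\<exists>a. \<forall>x\<in>X. ad a x = d x"
proof -
  interpret assoc_algebra smul
    using A by (simp add: locally_matrix_algebra_def)
  obtain n E where E: "0 < n" "matrix_units n E" and X: "X \<subseteq> span (unit_entries n E)"
    using locally_matrix_algebra_units[OF A \<open>finite X\<close>] by blast
  then show ?thesis
    using derivation_inner_on_matrix_units[OF E(2,1) d] by blast
qed

text \<open>Adding \<open>e\<close> to the finite set forces the diagonal sum of the matrix units to be \<open>e\<close>;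
  then \<open>\<phi>\<close> carries them to another system with diagonal sum \<open>\<phi>(e) = e\<close>.\<close>

lemma unital_endo_locally_inner:
  assumes A: "locally_matrix_algebra smul" and e: "identity_element e"
    and \<phi>: "algebra_endo smul \<phi>" "\<phi> e = e" and "finite X"
  shows "\<exists>g\<in>Inn e. \<forall>x\<in>X. g x = \<phi> x"
proof -
  interpret assoc_algebra smul
    using A by (simp add: locally_matrix_algebra_def)
  interpret endo: vector_space_pair smul smul ..
  interpret \<phi>: Vector_Spaces.linear smul smul \<phi>
    using \<phi>(1) by (simp add: algebra_endo_def)
  have mult: "\<phi> (x * y) = \<phi> x * \<phi> y" for x y
    using \<phi>(1) by (simp add: algebra_endo_def)
  obtain n E where E: "0 < n" "matrix_units n E" and X: "insert e X \<subseteq> span (unit_entries n E)"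
    using locally_matrix_algebra_units[OF A, of "insert e X"] \<open>finite X\<close> by auto
  have sumE: "(\<Sum>i<n. E i i) = e"
    using sum_diagonal_units(1)[OF E(2), of e] X e by (simp add: identity_element_def)
  have F: "matrix_units n (\<lambda>i j. \<phi> (E i j))"
    unfolding matrix_units_def by (auto simp: mult[symmetric] matrix_unitsD[OF E(2)] \<phi>.zero)
  have sumF: "(\<Sum>i<n. \<phi> (E i i)) = e"
    using sumE \<phi>(2) by (simp add: \<phi>.sum[symmetric])
  obtain a b where ab: "a * b = e" "b * a = e" and conj_E: "\<forall>k<n. \<forall>l<n. b * E k l * a = \<phi> (E k l)"
    using matrix_units_conjugate[OF A e E(2) sumE F sumF E(1)] by blast
  have "b * x * a = \<phi> x" if "x \<in> X" for x
  proof (rule endo.linear_eq_on[OF linear_comp[OF linear_mult_right linear_mult_left]])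
    show "Vector_Spaces.linear smul smul \<phi>" ..
    show "x \<in> span (unit_entries n E)"
      using X that by blast
  qed (use conj_E in \<open>auto elim!: unit_entriesE\<close>)
  moreover have "(\<lambda>x. b * x * a) \<in> Inn e"
    unfolding Inn_def using ab by (intro CollectI exI[of _ a] exI[of _ b]) simp
  ultimately show ?thesis
    by (intro bexI[of _ "\<lambda>x. b * x * a"]) auto
qed

section \<open>Inner maps, automorphisms and endomorphisms\<close>

lemma (in assoc_algebra) Inder_subset_Der: "Inder \<subseteq> Der smul"
proof -
  have "Vector_Spaces.linear smul smul (ad a)" for a
    by unfold_locales
      (simp_all add: ad_def algebra_simps scale_mult_left scale_mult_right scale_right_diff_distrib)
  then show ?thesis
    by (auto simp: Inder_def Der_def ad_def algebra_simps)
qed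

lemma (in assoc_algebra) Inn_subset_Aut:
  assumes e: "identity_element e"
  shows "Inn e \<subseteq> Aut smul"
proof
  fix g
  assume "g \<in> Inn e"
  then obtain a b where ab: "a * b = e" "b * a = e" and g: "g = (\<lambda>x. b * x * a)"
    unfolding Inn_def by blast
  have unit: "e * x = x" "x * e = x" for x
    using e by (auto simp: identity_element_def)
  have cancel: "a * (b * x) = x" "b * (a * x) = x" for x
    using ab unit by (metis mult.assoc)+
  have "Vector_Spaces.linear smul smul g"
    unfolding g by (rule linear_comp[OF linear_mult_right linear_mult_left])
  moreover have "g (x * y) = g x * g y" for x y
    unfolding g by (simp add: mult.assoc cancel)
  moreover have "bij g"
    by (rule o_bij[of "\<lambda>x. a * x * b"])
      (auto simp: g fun_eq_iff mult.assoc cancel ab unit)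
  ultimately show "g \<in> Aut smul"
    by (simp add: Aut_def algebra_endo_def)
qed

lemma Aut_subset_unital_inj_endos:
  assumes e: "identity_element e"
  shows "Aut smul \<subseteq> unital_inj_endos smul e"
proof
  fix f
  assume "f \<in> Aut smul"
  then have f: "algebra_endo smul f" "bij f"
    by (auto simp: Aut_def)
  obtain y where y: "f y = e"
    using bij_is_surj[OF f(2)] by (metis surjD)
  have "f e = f e * f y"
    using y e by (simp add: identity_element_def)
  also have "\<dots> = f (e * y)"
    using f(1) by (simp add: algebra_endo_def)
  also have "\<dots> = e"
    using y e by (simp add: identity_element_def)
  finally show "f \<in> unital_inj_endos smul e"
    using f by (simp add: unital_inj_endos_def bij_is_inj)
qed

text \<open>Each defining condition of a unital injective endomorphism involves at most three values
  of the map, hence is inherited from a member of \<open>S\<close> that agrees with \<open>f\<close> there.\<close>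

lemma (in assoc_algebra) unital_inj_endos_closed:
  assumes f: "f \<in> tykhonoff closure_of S" and S: "S \<subseteq> unital_inj_endos smul e"
  shows "f \<in> unital_inj_endos smul e"
proof -
  have agree: "\<exists>g. algebra_endo smul g \<and> inj g \<and> g e = e \<and> (\<forall>x\<in>X. g x = f x)" if "finite X" for X
  proof -
    obtain g where "g \<in> S" "\<forall>x\<in>X. g x = f x"
      using f \<open>finite X\<close> unfolding closure_of_tykhonoff_iff by meson
    then show ?thesis
      using S by (intro exI[of _ g]) (auto simp: unital_inj_endos_def)
  qed
  interpret endo: vector_space_pair smul smul ..
  have "f (x + y) = f x + f y" for x y
    using agree[of "{x, y, x + y}"] by (auto simp: algebra_endo_def endo.linear_add)
  moreover have "f (smul c x) = smul c (f x)" for c x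
    using agree[of "{x, smul c x}"] by (auto simp: algebra_endo_def endo.linear_scale)
  ultimately have "Vector_Spaces.linear smul smul f"
    by unfold_locales
  moreover have "f (x * y) = f x * f y" for x y
    using agree[of "{x, y, x * y}"] by (auto simp: algebra_endo_def)
  moreover have "inj f"
  proof (rule injI)
    fix x y
    assume "f x = f y"
    with agree[of "{x, y}"] show "x = y"
      by (metis injD insertCI finite.emptyI finite.insertI)
  qed
  moreover have "f e = e"
    using agree[of "{e}"] by auto
  ultimately show ?thesis
    by (simp add: unital_inj_endos_def algebra_endo_def)
qed

theorem theorem1:
  fixes smul :: "'f::field \<Rightarrow> 'a::ring \<Rightarrow> 'a"
  assumes "locally_matrix_algebra smul"
  shows "dense_in (subtopology tykhonoff (Der smul)) Inder \<and>
    (\<forall>e. identity_element e \<longrightarrow>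
      tykhonoff closure_of Inn e = unital_inj_endos smul e \<and>
      dense_in (subtopology tykhonoff (Aut smul)) (Inn e))"
proof (intro conjI allI impI)
  interpret assoc_algebra smul
    using assms by (simp add: locally_matrix_algebra_def)
  have "Der smul \<subseteq> tykhonoff closure_of Inder"
    using derivation_locally_inner[OF assms]
    unfolding closure_of_tykhonoff_iff subset_iff Inder_def by (metis rangeI)
  then show "dense_in (subtopology tykhonoff (Der smul)) Inder"
    by (rule dense_in_tykhonoff_subtopology[OF Inder_subset_Der])
  fix e :: 'a
  assume e: "identity_element e"
  have Inn_Aut: "Inn e \<subseteq> Aut smul"
    by (rule Inn_subset_Aut[OF e])
  have Aut_endos: "Aut smul \<subseteq> unital_inj_endos smul e"
    by (rule Aut_subset_unital_inj_endos[OF e])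
  show closure: "tykhonoff closure_of Inn e = unital_inj_endos smul e"
  proof
    show "tykhonoff closure_of Inn e \<subseteq> unital_inj_endos smul e"
      using unital_inj_endos_closed[OF _ subset_trans[OF Inn_Aut Aut_endos]] by (rule subsetI)
    show "unital_inj_endos smul e \<subseteq> tykhonoff closure_of Inn e"
      using unital_endo_locally_inner[OF assms e]
      by (auto simp: closure_of_tykhonoff_iff unital_inj_endos_def)
  qed
  then show "dense_in (subtopology tykhonoff (Aut smul)) (Inn e)"
    using dense_in_tykhonoff_subtopology[OF Inn_Aut] Aut_endos by simp
qed

end
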